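(* Let $\mathbf B$ be a boolean algebra of propositions with a calculus of finitary rules of inference. Let $T$ be a pretheory (a filter of $\mathbf B$) and let $P\in\mathbf B$ be a proposition. Then for every composite $\mathcal F$ of the functors $\mathrm{Fil}$ and $\mathrm{Idl}$, any proof of $P$ from $T$ covers the steps of order $\mathcal F$ in the proof of $P$ from $T$; that is, every step of order $\mathcal F$ in the proof of $P$ from $T$ is covered by at least one of the instances of rules of inference occurring in the given proof.
   Context: Lattice notions. A covering $x\prec y$ is a pair $x<y$ with no element strictly between. Write $\langle x,y\rangle\nearrow\langle z,w\rangle$ if $y\wedge z=x$ and $y\vee z=w$ (for $x\le y$, $z\le w$); projective equivalence $\sim$ is its symmetric and transitive closure. $\mathrm I[a,b]$ is the interval $\{z: a\le z\le b\}$. A covering $x\prec y$ in a complete modular lattice is upper regular if for every nonempty chain $I$ and every family of coverings $x_i\prec y_i$ ($i\in I$), each projectively equivalent to $x\prec y$ and with $\langle x_i,y_i\rangle\nearrow\langle x_j,y_j\rangle$ for $i<j$, we have $\bigvee_i x_i\prec\bigvee_i y_i$; lower regular is the dual; regular means both. It is known that for a regular covering the number of coverings projectively equivalent to it in a maximal chain is independent of the maximal chain; in a distributive lattice this number is $0$ or $1$, and the same holds for maximal chains of any interval $\mathrm I[a,b]$. $\mathrm{Fil}\,L$ is the lattice of filters (nonempty up-closed subsets closed under binary meets) of $L$ ordered by reverse inclusion; $\mathrm{Idl}\,L$ is the lattice of ideals (dual notion) ordered by inclusion. For $L$ bounded distributive both are complete, bounded and distributive. $L$ embeds in $\mathrm{Fil}\,L$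 by $x\mapsto\mathrm{Fg}\{x\}=\{z:z\ge x\}$ and in $\mathrm{Idl}\,L$ by $x\mapsto\mathrm{Ig}\{x\}=\{z:z\le x\}$. For a finite composite $\mathcal F$ of the functors $\mathrm{Fil}$ and $\mathrm{Idl}$, let $\phi:\mathrm{Fil}\,\mathbf B\to\mathcal F(\mathrm{Fil}\,\mathbf B)$ be the corresponding composite embedding. Logic. Elements of the boolean algebra $\mathbf B$ are called propositions. An instance $N$ of a rule of inference has a finite set of premises $S_N=\{P_1,\dots,P_n\}\subseteq\mathbf B$ and a conclusion $Q_N\in\mathbf B$. The rules include the trivial rules (infer $P\wedge Q$ from $P,Q$; infer $Q$ from $P$ when $P\le Q$) and possibly arbitrary further nontrivial finitary rules. A pretheory is a filter of $\mathbf B$. A proof of $P$ from $T$ is a finite sequence of instances $N_1,\dots,N_n$ of rules (trivial or nontrivial) such that each premise of $N_i$ lies in $T$ or is the conclusion of some $N_j$, $j<i$, and such that $P$ lies in $T$ or is the conclusion of some $N_i$. Steps. A step of order $\mathcal F$ is a regular covering in $\mathcal F(\mathrm{Fil}\,\mathbf B)$, considered up to projective equivalence. A step occurs in $\mathrm I[a,b]$ ($a\le b$ in $\mathcal F(\mathrm{Fil}\,\mathbf B)$) if some, equivalently every, maximal chain of $\mathrm I[a,b]$ contains a covering in its projective equivalence class. The steps of order $\mathcal F$ in the proof of $P$ from $T$ are those occurring in $\mathrm I[\phi(T)\wedge\phi(\mathrm{Fg}\{P\}),\phi(T)]$ (it is not assumed that $P$ is provable from $T$). An instance inferring $Q$ from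 $P_1,\dots,P_n$ covers the steps of order $\mathcal F$ occurring in $\mathrm I[\phi(\mathrm{Fg}\{Q\wedge\bigwedge_i P_i\}),\phi(\mathrm{Fg}\{\bigwedge_i P_i\})]$. A set (or sequence) of instances covers the union of the sets of steps covered by its members, and any subset of that union. *)

theory Defs
  imports "HOL-Algebra.Lattice"
begin

section \<open>Projectivity and regular coverings\<close>

definition covering :: "'u gorder \<Rightarrow> 'u \<times> 'u \<Rightarrow> bool" where
  "covering M = (\<lambda>(x, y). x \<in> carrier M \<and> y \<in> carrier M \<and> x \<sqsubset>\<^bsub>M\<^esub> y \<and>
     (\<nexists>z. z \<in> carrier M \<and> x \<sqsubset>\<^bsub>M\<^esub> z \<and> z \<sqsubset>\<^bsub>M\<^esub> y))"

definition nearrow :: "'u gorder \<Rightarrow> (('u \<times> 'u) \<times> ('u \<times> 'u)) set" where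
  "nearrow M = {((x, y), (z, w)).
     x \<in> carrier M \<and> y \<in> carrier M \<and> z \<in> carrier M \<and> w \<in> carrier M \<and>
     x \<sqsubseteq>\<^bsub>M\<^esub> y \<and> z \<sqsubseteq>\<^bsub>M\<^esub> w \<and> y \<sqinter>\<^bsub>M\<^esub> z = x \<and> y \<squnion>\<^bsub>M\<^esub> z = w}"

definition projective :: "'u gorder \<Rightarrow> (('u \<times> 'u) \<times> ('u \<times> 'u)) set" where
  "projective M = (nearrow M \<union> (nearrow M)\<inverse>)\<^sup>+"

text \<open>
  The index chains of the families are taken inside \<^typ>\<open>'u \<times> 'u\<close>. This loses no generality: the
  members of a family, as in the definition below but over an arbitrary chain, form a set of pairs
  that is linearly ordered by \<^const>\<open>nearrow\<close>, which can serve as the index chain instead.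
\<close>

definition upper_regular :: "'u gorder \<Rightarrow> 'u \<times> 'u \<Rightarrow> bool" where
  "upper_regular M c \<longleftrightarrow> covering M c \<and>
     (\<forall>(I :: ('u \<times> 'u) set) r x y.
        I \<noteq> {} \<longrightarrow> linear_order_on I r \<longrightarrow>
        (\<forall>i\<in>I. covering M (x i, y i) \<and> (c, (x i, y i)) \<in> projective M) \<longrightarrow>
        (\<forall>i\<in>I. \<forall>j\<in>I. (i, j) \<in> r \<and> i \<noteq> j \<longrightarrow> ((x i, y i), (x j, y j)) \<in> nearrow M) \<longrightarrow>
        covering M (\<Squnion>\<^bsub>M\<^esub>(x ` I), \<Squnion>\<^bsub>M\<^esub>(y ` I)))"

definition lower_regular :: "'u gorder \<Rightarrow> 'u \<times> 'u \<Rightarrow> bool" where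
  "lower_regular M = (\<lambda>(x, y). upper_regular (inv_gorder M) (y, x))"

definition regular :: "'u gorder \<Rightarrow> 'u \<times> 'u \<Rightarrow> bool" where
  "regular M c \<longleftrightarrow> upper_regular M c \<and> lower_regular M c"

text \<open>A step is a projective equivalence class of coverings containing a regular covering.\<close>

definition steps :: "'u gorder \<Rightarrow> ('u \<times> 'u) set set" where
  "steps M = {{d. covering M d \<and> (c, d) \<in> projective M} | c. regular M c}"

definition steps_in :: "'u gorder \<Rightarrow> 'u \<Rightarrow> 'u \<Rightarrow> ('u \<times> 'u) set set" where
  "steps_in M a b = {s \<in> steps M.
     \<exists>C. pred_on.maxchain \<lbrace>a..b\<rbrace>\<^bsub>M\<^esub> (\<sqsubseteq>\<^bsub>M\<^esub>) C \<and> (\<exists>(x, y)\<in>s. x \<in> C \<and> y \<in> C)}"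


section \<open>Filters, ideals and composites of the two functors\<close>

definition filters :: "'u gorder \<Rightarrow> 'u set set" where
  "filters L = {F. F \<subseteq> carrier L \<and> F \<noteq> {} \<and>
     (\<forall>x\<in>F. \<forall>y\<in>carrier L. x \<sqsubseteq>\<^bsub>L\<^esub> y \<longrightarrow> y \<in> F) \<and> (\<forall>x\<in>F. \<forall>y\<in>F. x \<sqinter>\<^bsub>L\<^esub> y \<in> F)}"

definition ideals :: "'u gorder \<Rightarrow> 'u set set" where
  "ideals L = {J. J \<subseteq> carrier L \<and> J \<noteq> {} \<and>
     (\<forall>x\<in>J. \<forall>y\<in>carrier L. y \<sqsubseteq>\<^bsub>L\<^esub> x \<longrightarrow> y \<in> J) \<and> (\<forall>x\<in>J. \<forall>y\<in>J. x \<squnion>\<^bsub>L\<^esub> y \<in> J)}"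

definition Fil :: "'u gorder \<Rightarrow> 'u set gorder" where
  "Fil L = \<lparr>carrier = filters L, eq = (=), le = (\<lambda>F G. G \<subseteq> F)\<rparr>"

definition Idl :: "'u gorder \<Rightarrow> 'u set gorder" where
  "Idl L = \<lparr>carrier = ideals L, eq = (=), le = (\<subseteq>)\<rparr>"

definition Fg :: "'u gorder \<Rightarrow> 'u \<Rightarrow> 'u set" where
  "Fg L x = {z \<in> carrier L. x \<sqsubseteq>\<^bsub>L\<^esub> z}"

definition Ig :: "'u gorder \<Rightarrow> 'u \<Rightarrow> 'u set" where
  "Ig L x = {z \<in> carrier L. z \<sqsubseteq>\<^bsub>L\<^esub> x}"

datatype ffun = FilF | IdlF

fun obj :: "ffun \<Rightarrow> 'u gorder \<Rightarrow> 'u set gorder" where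
  "obj FilF L = Fil L"
| "obj IdlF L = Idl L"

fun emb :: "ffun \<Rightarrow> 'u gorder \<Rightarrow> 'u \<Rightarrow> 'u set" where
  "emb FilF L = Fg L"
| "emb IdlF L = Ig L"

definition order_iso :: "'u gorder \<Rightarrow> 'v gorder \<Rightarrow> ('u \<Rightarrow> 'v) \<Rightarrow> bool" where
  "order_iso L M h \<longleftrightarrow> partial_order L \<and> partial_order M \<and> bij_betw h (carrier L) (carrier M) \<and>
     (\<forall>x\<in>carrier L. \<forall>y\<in>carrier L. h x \<sqsubseteq>\<^bsub>M\<^esub> h y \<longleftrightarrow> x \<sqsubseteq>\<^bsub>L\<^esub> y)"

text \<open>
  \<open>composite L Fs M \<phi>\<close> says that \<open>M\<close>, together with the map \<open>\<phi>\<close> from \<open>L\<close> to \<open>M\<close>, is a copy of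
  the lattice obtained from \<open>L\<close> by the functors in \<open>Fs\<close> (outermost first), together with the
  composite embedding. Literally, each functor leads from a type to the type of its sets, so that
  the type of the result depends on the length of \<open>Fs\<close>. To quantify over \<open>Fs\<close> inside the logic, the
  results at all stages are replaced by isomorphic copies in one type \<open>'u\<close>, on which nothing is
  assumed. Lemma \<open>composite_Fil_ba\<close> at the end shows that each composite over the filter lattice of a
  boolean algebra, taken literally, is an instance at its own type.
\<close>

inductive composite :: "'b gorder \<Rightarrow> ffun list \<Rightarrow> 'u gorder \<Rightarrow> ('b \<Rightarrow> 'u) \<Rightarrow> bool"
  for L :: "'b gorder" where
  base: "order_iso L M \<phi> \<Longrightarrow> composite L [] M \<phi>"
| step: "composite L Fs M \<phi> \<Longrightarrow> order_iso (obj F M) M' h \<Longrightarrow>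
    (\<And>x. x \<in> carrier L \<Longrightarrow> \<psi> x = h (emb F M (\<phi> x))) \<Longrightarrow> composite L (F # Fs) M' \<psi>"


section \<open>Calculi and proofs\<close>

definition ba :: "'a::boolean_algebra gorder" where
  "ba = \<lparr>carrier = UNIV, eq = (=), le = (\<le>)\<rparr>"

text \<open>An instance is a pair of its set of premises and its conclusion; a rule is the set of its
  instances.\<close>

type_synonym 'a inst = "'a set \<times> 'a"

definition conj_rule :: "'a::boolean_algebra inst set" where
  "conj_rule = {({P, Q}, P \<sqinter>\<^bsub>ba\<^esub> Q) | P Q. True}"

definition weaken_rule :: "'a::boolean_algebra inst set" where
  "weaken_rule = {({P}, Q) | P Q. P \<le> Q}"

definition calculus :: "'a::boolean_algebra inst set set \<Rightarrow> bool" where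
  "calculus Rs \<longleftrightarrow> conj_rule \<in> Rs \<and> weaken_rule \<in> Rs \<and> (\<forall>R\<in>Rs. \<forall>(S, Q)\<in>R. finite S)"

definition is_proof ::
    "'a::boolean_algebra inst set set \<Rightarrow> 'a set \<Rightarrow> 'a inst list \<Rightarrow> 'a \<Rightarrow> bool" where
  "is_proof Rs T Ns P \<longleftrightarrow>
     (\<forall>i<length Ns. Ns ! i \<in> \<Union>Rs \<and> (\<forall>p\<in>fst (Ns ! i). p \<in> T \<or> (\<exists>j<i. p = snd (Ns ! j)))) \<and>
     (P \<in> T \<or> (\<exists>i<length Ns. P = snd (Ns ! i)))"

definition steps_of_proof ::
    "'u gorder \<Rightarrow> ('a::boolean_algebra set \<Rightarrow> 'u) \<Rightarrow> 'a set \<Rightarrow> 'a \<Rightarrow> ('u \<times> 'u) set set" where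
  "steps_of_proof M \<phi> T P = steps_in M (\<phi> T \<sqinter>\<^bsub>M\<^esub> \<phi> (Fg ba P)) (\<phi> T)"

definition steps_of_inst ::
    "'u gorder \<Rightarrow> ('a::boolean_algebra set \<Rightarrow> 'u) \<Rightarrow> 'a inst \<Rightarrow> ('u \<times> 'u) set set" where
  "steps_of_inst M \<phi> = (\<lambda>(S, Q).
     steps_in M (\<phi> (Fg ba (Q \<sqinter>\<^bsub>ba\<^esub> \<Sqinter>\<^bsub>ba\<^esub>S))) (\<phi> (Fg ba (\<Sqinter>\<^bsub>ba\<^esub>S))))"

definition covers ::
    "'u gorder \<Rightarrow> ('a::boolean_algebra set \<Rightarrow> 'u) \<Rightarrow> 'a inst set \<Rightarrow> ('u \<times> 'u) set set \<Rightarrow> bool" where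
  "covers M \<phi> A X \<longleftrightarrow> X \<subseteq> (\<Union>N\<in>A. steps_of_inst M \<phi> N)"


section \<open>Literal composites are composites\<close>

lemma Idl_dual: "Idl L = inv_gorder (Fil (inv_gorder L))"
  by (simp add: Idl_def Fil_def ideals_def filters_def)

lemma partial_order_Fil: "partial_order (Fil L)"
  by standard (auto simp: Fil_def)

lemma filtersD:
  assumes "F \<in> filters L"
  shows "F \<subseteq> carrier L" "F \<noteq> {}"
    and "x \<in> F \<Longrightarrow> y \<in> carrier L \<Longrightarrow> x \<sqsubseteq>\<^bsub>L\<^esub> y \<Longrightarrow> y \<in> F"
    and "x \<in> F \<Longrightarrow> y \<in> F \<Longrightarrow> x \<sqinter>\<^bsub>L\<^esub> y \<in> F"
  using assms by (simp_all add: filters_def)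

lemma filtersI:
  assumes "F \<subseteq> carrier L" "F \<noteq> {}"
    and "\<And>x y. x \<in> F \<Longrightarrow> y \<in> carrier L \<Longrightarrow> x \<sqsubseteq>\<^bsub>L\<^esub> y \<Longrightarrow> y \<in> F"
    and "\<And>x y. x \<in> F \<Longrightarrow> y \<in> F \<Longrightarrow> x \<sqinter>\<^bsub>L\<^esub> y \<in> F"
  shows "F \<in> filters L"
  unfolding filters_def using assms by blast

lemma lattice_Fil:
  assumes "lattice L"
  shows "lattice (Fil L)"
proof -
  interpret lattice L by fact
  interpret F: partial_order "Fil L" by (rule partial_order_Fil)
  have "\<exists>s. least (Fil L) s (Upper (Fil L) {F, G})" 
    if F: "F \<in> filters L" and G: "G \<in> filters L" for F G
  proof -
    obtain a b where ab: "a \<in> F" "b \<in> G" "a \<in> carrier L" "b \<in> carrier L"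
      using filtersD(1,2)[OF F] filtersD(1,2)[OF G] by blast
    have "a \<sqsubseteq>\<^bsub>L\<^esub> a \<squnion>\<^bsub>L\<^esub> b" "b \<sqsubseteq>\<^bsub>L\<^esub> a \<squnion>\<^bsub>L\<^esub> b" "a \<squnion>\<^bsub>L\<^esub> b \<in> carrier L"
      by (fact join_left[OF ab(3,4)] join_right[OF ab(3,4)] join_closed[OF ab(3,4)])+
    then have "a \<squnion>\<^bsub>L\<^esub> b \<in> F \<inter> G"
      using filtersD(3)[OF F ab(1)] filtersD(3)[OF G ab(2)] by blast
    then have "F \<inter> G \<noteq> {}" by blast
    moreover have "F \<inter> G \<subseteq> carrier L" using filtersD(1)[OF F] by blast
    moreover have "y \<in> F \<inter> G" if "x \<in> F \<inter> G" "y \<in> carrier L" "x \<sqsubseteq>\<^bsub>L\<^esub> y" for x y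
      using that filtersD(3)[OF F] filtersD(3)[OF G] by blast
    moreover have "x \<sqinter>\<^bsub>L\<^esub> y \<in> F \<inter> G" if "x \<in> F \<inter> G" "y \<in> F \<inter> G" for x y
      using that filtersD(4)[OF F] filtersD(4)[OF G] by blast
    ultimately have "F \<inter> G \<in> filters L" by (intro filtersI)
    then have "least (Fil L) (F \<inter> G) (Upper (Fil L) {F, G})"
      using F G unfolding least_def Upper_def by (auto simp: Fil_def)
    then show ?thesis by blast
  qed
  moreover have "\<exists>s. greatest (Fil L) s (Lower (Fil L) {F, G})"
    if F: "F \<in> filters L" and G: "G \<in> filters L" for F G
  proof -
    define H where "H = {z \<in> carrier L. \<exists>a\<in>F. \<exists>b\<in>G. a \<sqinter>\<^bsub>L\<^esub> b \<sqsubseteq>\<^bsub>L\<^esub> z}"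
    obtain a b where ab: "a \<in> F" "b \<in> G" using filtersD(2)[OF F] filtersD(2)[OF G] by blast
    have sub: "x \<in> carrier L" if "x \<in> F \<or> x \<in> G" for x
      using filtersD(1)[OF F] filtersD(1)[OF G] that by blast
    have H1: "F \<subseteq> H"
    proof
      fix x assume "x \<in> F"
      then show "x \<in> H" using ab sub meet_left[of x b] unfolding H_def by blast
    qed
    have H2: "G \<subseteq> H"
    proof
      fix x assume "x \<in> G"
      then show "x \<in> H" using ab sub meet_right[of a x] unfolding H_def by blast
    qed
    have H3: "x \<sqinter>\<^bsub>L\<^esub> y \<in> H" if x: "x \<in> H" and y: "y \<in> H" for x y
    proof -
      obtain a b c d where *: "a \<in> F" "b \<in> G" "a \<sqinter>\<^bsub>L\<^esub> b \<sqsubseteq>\<^bsub>L\<^esub> x" "c \<in> F" "d \<in> G" "c \<sqinter>\<^bsub>L\<^esub> d \<sqsubseteq>\<^bsub>L\<^esub> y"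
        "x \<in> carrier L" "y \<in> carrier L"
        using x y unfolding H_def by blast
      have c: "a \<in> carrier L" "b \<in> carrier L" "c \<in> carrier L" "d \<in> carrier L"
        using * sub by blast+
      have in': "a \<sqinter>\<^bsub>L\<^esub> c \<in> F" "b \<sqinter>\<^bsub>L\<^esub> d \<in> G"
        using * filtersD(4)[OF F] filtersD(4)[OF G] by simp_all
      let ?m = "(a \<sqinter>\<^bsub>L\<^esub> c) \<sqinter>\<^bsub>L\<^esub> (b \<sqinter>\<^bsub>L\<^esub> d)"
      have cl: "a \<sqinter>\<^bsub>L\<^esub> c \<in> carrier L" "b \<sqinter>\<^bsub>L\<^esub> d \<in> carrier L" "?m \<in> carrier L"
        "a \<sqinter>\<^bsub>L\<^esub> b \<in> carrier L" "c \<sqinter>\<^bsub>L\<^esub> d \<in> carrier L" "x \<sqinter>\<^bsub>L\<^esub> y \<in> carrier L"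
        using c * meet_closed by simp_all
      have "?m \<sqsubseteq>\<^bsub>L\<^esub> a" "?m \<sqsubseteq>\<^bsub>L\<^esub> c"
        using le_trans[OF meet_left[OF cl(1,2)]] meet_left[OF c(1,3)] meet_right[OF c(1,3)] cl c
        by simp_all
      moreover have "?m \<sqsubseteq>\<^bsub>L\<^esub> b" "?m \<sqsubseteq>\<^bsub>L\<^esub> d"
        using le_trans[OF meet_right[OF cl(1,2)]] meet_left[OF c(2,4)] meet_right[OF c(2,4)] cl c
        by simp_all
      ultimately have "?m \<sqsubseteq>\<^bsub>L\<^esub> a \<sqinter>\<^bsub>L\<^esub> b" "?m \<sqsubseteq>\<^bsub>L\<^esub> c \<sqinter>\<^bsub>L\<^esub> d"
        using c cl meet_le by simp_all
      then have "?m \<sqsubseteq>\<^bsub>L\<^esub> x" "?m \<sqsubseteq>\<^bsub>L\<^esub> y"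
        using * cl le_trans[of ?m "a \<sqinter>\<^bsub>L\<^esub> b" x] le_trans[of ?m "c \<sqinter>\<^bsub>L\<^esub> d" y] by simp_all
      then have "?m \<sqsubseteq>\<^bsub>L\<^esub> x \<sqinter>\<^bsub>L\<^esub> y" using * cl meet_le by simp
      then show ?thesis using in' cl unfolding H_def by blast
    qed
    have H4: "y \<in> H" if xy: "x \<in> H" "y \<in> carrier L" "x \<sqsubseteq>\<^bsub>L\<^esub> y" for x y
    proof -
      obtain a b where *: "a \<in> F" "b \<in> G" "a \<sqinter>\<^bsub>L\<^esub> b \<sqsubseteq>\<^bsub>L\<^esub> x" "x \<in> carrier L"
        using xy unfolding H_def by blast
      then have "a \<sqinter>\<^bsub>L\<^esub> b \<sqsubseteq>\<^bsub>L\<^esub> y"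
        using le_trans[of "a \<sqinter>\<^bsub>L\<^esub> b" x y] xy sub meet_closed by simp
      then show ?thesis using * xy unfolding H_def by blast
    qed
    have H5: "H \<subseteq> carrier L" "H \<noteq> {}" using ab H1 by (auto simp: H_def)
    have H6: "H \<in> filters L"
      using H3 H4 H5 by (intro filtersI)
    have H7: "H \<subseteq> K" if K: "K \<in> filters L" "F \<subseteq> K" "G \<subseteq> K" for K
    proof
      fix z assume "z \<in> H"
      then obtain a b where *: "a \<in> F" "b \<in> G" "a \<sqinter>\<^bsub>L\<^esub> b \<sqsubseteq>\<^bsub>L\<^esub> z" "z \<in> carrier L"
        unfolding H_def by blast
      then have "a \<sqinter>\<^bsub>L\<^esub> b \<in> K"
        using filtersD(4)[OF K(1), of a b] K(2,3) by blast
      then show "z \<in> K" using filtersD(3)[OF K(1)] * by blast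
    qed
    have "greatest (Fil L) H (Lower (Fil L) {F, G})"
      using F G H1 H2 H6 H7 unfolding greatest_def Lower_def by (auto simp: Fil_def)
    then show ?thesis by blast
  qed
  ultimately show ?thesis
    by (unfold_locales) (metis Fil_def partial_object.select_convs(1))+
qed

lemma lattice_obj: "lattice L \<Longrightarrow> lattice (obj F L)"
  by (cases F) (auto simp: lattice_Fil Idl_dual intro!: lattice.dual_lattice lattice_Fil)

lemma order_iso_trans:
  "order_iso L M g \<Longrightarrow> order_iso M N h \<Longrightarrow> order_iso L N (h \<circ> g)"
  unfolding order_iso_def by (auto intro: bij_betw_trans dest: bij_betwE)

lemma order_iso_dual: "order_iso L M h \<Longrightarrow> order_iso (inv_gorder L) (inv_gorder M) h"
  by (auto simp: order_iso_def dual_order_iff)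

lemma order_iso_glb:
  assumes h: "order_iso L M h" and x: "x \<in> carrier L" "y \<in> carrier L"
    and g: "greatest L g (Lower L {x, y})"
  shows "greatest M (h g) (Lower M {h x, h y})"
proof -
  have b: "h ` carrier L = carrier M" and le: "\<And>a b. a \<in> carrier L \<Longrightarrow> b \<in> carrier L \<Longrightarrow> h a \<sqsubseteq>\<^bsub>M\<^esub> h b \<longleftrightarrow> a \<sqsubseteq>\<^bsub>L\<^esub> b"
    using h by (auto simp: order_iso_def bij_betw_def)
  show ?thesis
    using g x unfolding greatest_def Lower_def b[symmetric] by (auto simp: le)
qed

lemma order_iso_lattice:
  assumes h: "order_iso L M h" and "lattice L"
  shows "lattice M"
proof -
  interpret L: lattice L by fact
  interpret M: partial_order M using h by (simp add: order_iso_def)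
  have b: "h ` carrier L = carrier M" using h by (auto simp: order_iso_def bij_betw_def)
  show ?thesis
  proof
    fix x y assume "x \<in> carrier M" "y \<in> carrier M"
    then obtain a c where ac: "a \<in> carrier L" "c \<in> carrier L" "x = h a" "y = h c"
      using b by blast
    show "\<exists>s. greatest M s (Lower M {x, y})"
      using L.inf_of_two_exists[OF ac(1,2)] order_iso_glb[OF h ac(1,2)] unfolding ac(3,4) by fast
    show "\<exists>s. least M s (Upper M {x, y})"
      using L.sup_of_two_exists[OF ac(1,2)] order_iso_glb[OF order_iso_dual[OF h], of a c] ac(1,2)
      unfolding ac(3,4) by fastforce
  qed
qed

lemma order_iso_meet:
  assumes h: "order_iso L M h" and "lattice L" and x: "x \<in> carrier L" "y \<in> carrier L"
  shows "h (x \<sqinter>\<^bsub>L\<^esub> y) = h x \<sqinter>\<^bsub>M\<^esub> h y"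
proof -
  interpret L: lattice L by fact
  interpret M: lattice M using h \<open>lattice L\<close> by (rule order_iso_lattice)
  have c: "h x \<in> carrier M" "h y \<in> carrier M"
    using h x by (auto simp: order_iso_def bij_betw_def)
  have "greatest L (x \<sqinter>\<^bsub>L\<^esub> y) (Lower L {x, y})"
    unfolding meet_def using L.inf_of_two_greatest x by blast
  from order_iso_glb[OF h x this]
  have "greatest M (h (x \<sqinter>\<^bsub>L\<^esub> y)) (Lower M {h x, h y})" .
  moreover have "greatest M (h x \<sqinter>\<^bsub>M\<^esub> h y) (Lower M {h x, h y})"
    unfolding meet_def using M.inf_of_two_greatest c by blast
  ultimately show ?thesis by (rule M.greatest_unique)
qed

lemma order_iso_Fil:
  assumes h: "order_iso L M h" and "lattice L"
  shows "order_iso (Fil L) (Fil M) ((`) h)"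
proof -
  have b: "h ` carrier L = carrier M" and inj: "inj_on h (carrier L)"
    and le: "\<And>a b. a \<in> carrier L \<Longrightarrow> b \<in> carrier L \<Longrightarrow> h a \<sqsubseteq>\<^bsub>M\<^esub> h b \<longleftrightarrow> a \<sqsubseteq>\<^bsub>L\<^esub> b"
    using h by (auto simp: order_iso_def bij_betw_def)
  note m = order_iso_meet[OF h \<open>lattice L\<close>, symmetric]
  have sub: "F \<subseteq> carrier L" if "F \<in> filters L" for F using that by (simp add: filters_def)
  have 1: "h ` F \<in> filters M" if F: "F \<in> filters L" for F
  proof -
    have "h ` F \<subseteq> carrier M" using sub[OF F] b by blast
    moreover have "h ` F \<noteq> {}" using F by (simp add: filters_def)
    moreover have "y \<in> h ` F" if xy: "x \<in> h ` F" "y \<in> carrier M" "x \<sqsubseteq>\<^bsub>M\<^esub> y" for x y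
    proof -
      obtain a c where ac: "a \<in> F" "x = h a" "c \<in> carrier L" "y = h c"
        using xy b by (metis imageE)
      then have "a \<sqsubseteq>\<^bsub>L\<^esub> c" using xy le sub[OF F] by (metis subsetD)
      then show ?thesis using ac F by (simp add: filters_def)
    qed
    moreover have "x \<sqinter>\<^bsub>M\<^esub> y \<in> h ` F" if xy: "x \<in> h ` F" "y \<in> h ` F" for x y
    proof -
      obtain a c where ac: "a \<in> F" "x = h a" "c \<in> F" "y = h c" using xy by (metis imageE)
      then have "x \<sqinter>\<^bsub>M\<^esub> y = h (a \<sqinter>\<^bsub>L\<^esub> c)" using m sub[OF F] by (metis subsetD)
      then show ?thesis using ac F by (simp add: filters_def)
    qed
    ultimately show ?thesis by (simp add: filters_def)
  qed
  have 2: "\<exists>F\<in>filters L. G = h ` F" if G: "G \<in> filters M" for G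
  proof
    let ?F = "{x \<in> carrier L. h x \<in> G}"
    interpret L: lattice L by fact
    have "G \<subseteq> carrier M" "G \<noteq> {}" using G by (simp_all add: filters_def)
    then show *: "G = h ` ?F" unfolding b[symmetric] by blast
    with \<open>G \<noteq> {}\<close> have "?F \<noteq> {}" by (metis image_empty)
    moreover have "x \<sqinter>\<^bsub>L\<^esub> y \<in> ?F" if "x \<in> ?F" "y \<in> ?F" for x y
      using G that m[of x y] by (simp add: filters_def) metis
    moreover have "y \<in> ?F" if "x \<in> ?F" "y \<in> carrier L" "x \<sqsubseteq>\<^bsub>L\<^esub> y" for x y
    proof -
      have "h x \<sqsubseteq>\<^bsub>M\<^esub> h y" "h y \<in> carrier M" "h x \<in> G"
        using that le[of x y] imageI[of y "carrier L" h] b by simp_all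
      then show ?thesis using G that by (simp add: filters_def)
    qed
    moreover have "?F \<subseteq> carrier L" by blast
    ultimately show "?F \<in> filters L" unfolding filters_def by blast
  qed
  have 3: "inj_on ((`) h) (filters L)"
    by (rule inj_onI) (metis inj_on_image_eq_iff[OF inj] sub)
  have 4: "(`) h ` filters L = filters M" using 1 2 by blast
  have 5: "h ` G \<subseteq> h ` F \<longleftrightarrow> G \<subseteq> F" if "F \<in> filters L" "G \<in> filters L" for F G
    using inj_on_image_mem_iff[OF inj] sub[OF that(1)] sub[OF that(2)] by (metis (no_types, lifting) image_mono imageI subset_iff)
  show ?thesis
    unfolding order_iso_def bij_betw_def
    using 3 4 5 partial_order_Fil[of L] partial_order_Fil[of M] by (simp add: Fil_def)
qed

lemma order_iso_obj:
  assumes "order_iso L M h" "lattice L"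
  shows "order_iso (obj F L) (obj F M) ((`) h)"
proof (cases F)
  case IdlF
  have "order_iso (inv_gorder (Fil (inv_gorder L))) (inv_gorder (Fil (inv_gorder M))) ((`) h)"
    using assms by (intro order_iso_dual order_iso_Fil lattice.dual_lattice)
  with IdlF show ?thesis by (simp add: Idl_dual)
qed (use assms order_iso_Fil in simp)

text \<open>The copy of \<^term>\<open>M\<close> along an injective map \<^term>\<open>f\<close>.\<close>

definition transport :: "('u \<Rightarrow> 'v) \<Rightarrow> 'u gorder \<Rightarrow> 'v gorder" where
  "transport f M =
     \<lparr>carrier = f ` carrier M, eq = (=), le = (\<lambda>u v. inv f u \<sqsubseteq>\<^bsub>M\<^esub> inv f v)\<rparr>"

lemma order_iso_transport:
  assumes "inj f" "partial_order M"
  shows "order_iso (transport f M) M (inv f)"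
proof -
  interpret M: partial_order M by fact
  have "partial_order (transport f M)"
    by standard (use \<open>inj f\<close> in \<open>auto simp: transport_def intro: M.le_trans dest: M.le_antisym\<close>)
  then show ?thesis
    unfolding order_iso_def bij_betw_def
    using assms by (auto simp: transport_def image_image intro!: inj_onI)
qed

lemma order_iso_transport':
  assumes f: "inj f" and "partial_order M"
  shows "order_iso M (transport f M) f"
  using order_iso_transport[OF assms] inj_on_subset[OF f subset_UNIV] inv_f_f[OF f]
  by (simp add: order_iso_def bij_betw_def transport_def)

lemma emb_transport:
  assumes "inj f" shows "inv f ` emb F (transport f M) (f x) = emb F M x"
  using assms by (cases F) (force simp: Fg_def Ig_def transport_def image_iff)+

lemma composite_lattice: "composite L Fs M \<phi> \<Longrightarrow> lattice L \<Longrightarrow> lattice M"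
  by (induction rule: composite.induct) (auto intro: order_iso_lattice lattice_obj)

lemma composite_copy:
  fixes f :: "'u \<Rightarrow> 'v" and M :: "'u gorder" and K :: "'v gorder"
  assumes "composite L Fs M \<phi>" and L: "lattice L" and f: "inj f"
    and "order_iso M K e"
  shows "composite L Fs K (e \<circ> \<phi>)"
  using assms(1,4)
proof (induction arbitrary: K e rule: composite.induct)
  case (base M \<phi>)
  then show ?case by (blast intro: composite.base order_iso_trans)
next
  case (step Fs M \<phi> F M' h \<psi>)
  have M: "lattice M" using step.hyps L by (blast intro: composite_lattice)
  then interpret M: lattice M .
  have i: "order_iso (transport f M) M (inv f)"
    using f M.partial_order_axioms by (rule order_iso_transport)
  have j: "order_iso M (transport f M) f"
    using f M.partial_order_axioms by (rule order_iso_transport')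
  have "order_iso (obj F (transport f M)) (obj F M) ((`) (inv f))"
    using order_iso_obj[OF i] order_iso_lattice[OF j M] by blast
  then have "order_iso (obj F (transport f M)) K (e \<circ> (h \<circ> (`) (inv f)))"
    by (rule order_iso_trans[OF order_iso_trans[OF _ step.hyps(2)] step.prems])
  then show ?case
    by (rule composite.step[OF step.IH[OF j]])
      (simp add: emb_transport[OF f] step.hyps(3))
qed

lemma composite_base: "partial_order L \<Longrightarrow> composite L [] L id"
  by (rule composite.base) (simp add: order_iso_def)

lemma composite_literal:
  assumes "composite L Fs M \<phi>" and L: "lattice L"
  shows "composite L (F # Fs) (obj F M) (\<lambda>x. emb F M (\<phi> x))"
proof -
  let ?f = "\<lambda>x. {x}"
  have f: "inj ?f" by (auto intro: injI)
  have M: "lattice M" using assms by (rule composite_lattice)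
  then interpret M: lattice M .
  have i: "order_iso (transport ?f M) M (inv ?f)"
    using f M.partial_order_axioms by (rule order_iso_transport)
  have j: "order_iso M (transport ?f M) ?f"
    using f M.partial_order_axioms by (rule order_iso_transport')
  have "order_iso (obj F (transport ?f M)) (obj F M) ((`) (inv ?f))"
    using order_iso_obj[OF i] order_iso_lattice[OF j M] by blast
  then show ?thesis
    by (rule composite.step[OF composite_copy[OF assms f j]])
      (simp add: emb_transport[OF f])
qed

lemma lattice_ba: "lattice (ba :: 'a::boolean_algebra gorder)"
proof -
  interpret partial_order "ba :: 'a gorder" by standard (auto simp: ba_def)
  show ?thesis
  proof
    fix x y :: 'a
    have "least ba (Lattices.sup x y) (Upper ba {x, y})"
      by (simp add: ba_def least_def Upper_def)
    then show "\<exists>s. least ba s (Upper ba {x, y})" by blast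
    have "greatest ba (Lattices.inf x y) (Lower ba {x, y})"
      by (simp add: ba_def greatest_def Lower_def)
    then show "\<exists>s. greatest ba s (Lower ba {x, y})" by blast
  qed
qed

lemma composite_Fil_ba:
  "composite (Fil ba) [] (Fil ba) id"
  "composite (Fil ba) Fs M \<phi> \<Longrightarrow> composite (Fil ba) (F # Fs) (obj F M) (\<lambda>x. emb F M (\<phi> x))"
  using composite_base[OF partial_order_Fil] composite_literal lattice_Fil[OF lattice_ba] by blast+

end

theory Submission
  imports Defs
begin

text \<open>
  In a distributive lattice, if \<open>x \<prec> y\<close> lies in \<open>[a, b]\<close> and \<open>a \<le> m \<le> b\<close>, then \<open>x \<prec> y\<close> is
  transposed to \<open>x \<and> m \<prec> y \<and> m\<close> in \<open>[a, m]\<close> or to \<open>x \<or> m \<prec> y \<or> m\<close> in \<open>[m, b]\<close>. So a step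
  occurring in an interval occurs in some link of any finite chain from its top to its bottom.
  Take the chain \<open>a\<^sub>0 = \<phi> T\<close>, \<open>a\<^sub>i\<^sub>+\<^sub>1 = a\<^sub>i \<and> \<phi> (Fg Q\<^sub>i)\<close> along the conclusions of the proof, which
  ends below \<open>\<phi> T \<and> \<phi> (Fg P)\<close>. If \<open>S\<^sub>i\<close> are the premises of the \<open>i\<close>-th instance, then
  \<open>a\<^sub>i \<le> \<phi> (Fg (\<And>S\<^sub>i))\<close>, and the link \<open>[a\<^sub>i\<^sub>+\<^sub>1, a\<^sub>i]\<close> is transposed up into the interval of that
  instance.
\<close>

section \<open>Distributivity\<close>

text \<open>
  Distributivity in the form \<open>a \<and> b \<le> c \<Longrightarrow> a \<le> b \<or> c \<Longrightarrow> a \<le> c\<close>, with the lattice operations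
  spelled out: in this form it is self-dual and visibly invariant under order isomorphisms.
\<close>

definition distributive :: "'u gorder \<Rightarrow> bool" where
  "distributive L \<longleftrightarrow> (\<forall>a\<in>carrier L. \<forall>b\<in>carrier L. \<forall>c\<in>carrier L.
     (\<forall>u\<in>carrier L. u \<sqsubseteq>\<^bsub>L\<^esub> a \<and> u \<sqsubseteq>\<^bsub>L\<^esub> b \<longrightarrow> u \<sqsubseteq>\<^bsub>L\<^esub> c) \<and>
     (\<forall>u\<in>carrier L. b \<sqsubseteq>\<^bsub>L\<^esub> u \<and> c \<sqsubseteq>\<^bsub>L\<^esub> u \<longrightarrow> a \<sqsubseteq>\<^bsub>L\<^esub> u) \<longrightarrow> a \<sqsubseteq>\<^bsub>L\<^esub> c)"

lemma distributiveI:
  assumes "\<And>a b c. \<lbrakk>a \<in> carrier L; b \<in> carrier L; c \<in> carrier L;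
    \<And>u. u \<in> carrier L \<Longrightarrow> u \<sqsubseteq>\<^bsub>L\<^esub> a \<Longrightarrow> u \<sqsubseteq>\<^bsub>L\<^esub> b \<Longrightarrow> u \<sqsubseteq>\<^bsub>L\<^esub> c;
    \<And>u. u \<in> carrier L \<Longrightarrow> b \<sqsubseteq>\<^bsub>L\<^esub> u \<Longrightarrow> c \<sqsubseteq>\<^bsub>L\<^esub> u \<Longrightarrow> a \<sqsubseteq>\<^bsub>L\<^esub> u\<rbrakk> \<Longrightarrow> a \<sqsubseteq>\<^bsub>L\<^esub> c"
  shows "distributive L"
  unfolding distributive_def
proof (intro ballI impI, elim conjE)
  fix a b c
  assume "a \<in> carrier L" "b \<in> carrier L" "c \<in> carrier L"
    and 1: "\<forall>u\<in>carrier L. u \<sqsubseteq>\<^bsub>L\<^esub> a \<and> u \<sqsubseteq>\<^bsub>L\<^esub> b \<longrightarrow> u \<sqsubseteq>\<^bsub>L\<^esub> c"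
    and 2: "\<forall>u\<in>carrier L. b \<sqsubseteq>\<^bsub>L\<^esub> u \<and> c \<sqsubseteq>\<^bsub>L\<^esub> u \<longrightarrow> a \<sqsubseteq>\<^bsub>L\<^esub> u"
  then show "a \<sqsubseteq>\<^bsub>L\<^esub> c"
    by (intro assms[of a b c] 1[rule_format] 2[rule_format] conjI)
qed

lemma distributiveD:
  assumes "distributive L" "a \<in> carrier L" "b \<in> carrier L" "c \<in> carrier L"
    and "\<And>u. u \<in> carrier L \<Longrightarrow> u \<sqsubseteq>\<^bsub>L\<^esub> a \<Longrightarrow> u \<sqsubseteq>\<^bsub>L\<^esub> b \<Longrightarrow> u \<sqsubseteq>\<^bsub>L\<^esub> c"
    and "\<And>u. u \<in> carrier L \<Longrightarrow> b \<sqsubseteq>\<^bsub>L\<^esub> u \<Longrightarrow> c \<sqsubseteq>\<^bsub>L\<^esub> u \<Longrightarrow> a \<sqsubseteq>\<^bsub>L\<^esub> u"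
  shows "a \<sqsubseteq>\<^bsub>L\<^esub> c"
proof -
  have "\<forall>u\<in>carrier L. u \<sqsubseteq>\<^bsub>L\<^esub> a \<and> u \<sqsubseteq>\<^bsub>L\<^esub> b \<longrightarrow> u \<sqsubseteq>\<^bsub>L\<^esub> c"
    by (intro ballI impI, elim conjE) (fact assms(5))
  moreover have "\<forall>u\<in>carrier L. b \<sqsubseteq>\<^bsub>L\<^esub> u \<and> c \<sqsubseteq>\<^bsub>L\<^esub> u \<longrightarrow> a \<sqsubseteq>\<^bsub>L\<^esub> u"
    by (intro ballI impI, elim conjE) (fact assms(6))
  ultimately show ?thesis using assms(1-4) unfolding distributive_def by blast
qed

text \<open>Reversing the order exchanges the two hypotheses of the condition and swaps
  \<open>a\<close> with \<open>c\<close>.\<close>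

lemma distributive_dual:
  assumes "distributive L"
  shows "distributive (inv_gorder L)"
  by (rule distributiveI, unfold gorder.select_convs partial_object.select_convs)
    (rule distributiveD[OF assms])

lemma distributive_ba: "distributive (ba :: 'a::boolean_algebra gorder)"
proof (rule distributiveI, unfold ba_def gorder.select_convs partial_object.select_convs)
  fix a b c :: 'a
  assume 1: "\<And>u. u \<in> UNIV \<Longrightarrow> u \<le> a \<Longrightarrow> u \<le> b \<Longrightarrow> u \<le> c"
    and 2: "\<And>u. u \<in> UNIV \<Longrightarrow> b \<le> u \<Longrightarrow> c \<le> u \<Longrightarrow> a \<le> u"
  have "a \<le> Lattices.sup b c" by (rule 2) simp_all
  then have "a = Lattices.inf a (Lattices.sup b c)" by (simp add: inf_absorb1)
  also have "\<dots> = Lattices.sup (Lattices.inf a b) (Lattices.inf a c)" by (rule inf_sup_distrib1)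
  also have "\<dots> \<le> c"
  proof (rule sup_least)
    show "Lattices.inf a b \<le> c" by (rule 1) simp_all
  qed simp
  finally show "a \<le> c" .
qed

lemma order_iso_distributive:
  assumes h: "order_iso L M h" and L: "distributive L"
  shows "distributive M"
proof (rule distributiveI)
  have b: "carrier M = h ` carrier L"
    and le: "\<And>a b. a \<in> carrier L \<Longrightarrow> b \<in> carrier L \<Longrightarrow> h a \<sqsubseteq>\<^bsub>M\<^esub> h b \<longleftrightarrow> a \<sqsubseteq>\<^bsub>L\<^esub> b"
    using h by (auto simp: order_iso_def bij_betw_def)
  fix a b c
  assume c: "a \<in> carrier M" "b \<in> carrier M" "c \<in> carrier M"
    and 1: "\<And>u. u \<in> carrier M \<Longrightarrow> u \<sqsubseteq>\<^bsub>M\<^esub> a \<Longrightarrow> u \<sqsubseteq>\<^bsub>M\<^esub> b \<Longrightarrow> u \<sqsubseteq>\<^bsub>M\<^esub> c"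
    and 2: "\<And>u. u \<in> carrier M \<Longrightarrow> b \<sqsubseteq>\<^bsub>M\<^esub> u \<Longrightarrow> c \<sqsubseteq>\<^bsub>M\<^esub> u \<Longrightarrow> a \<sqsubseteq>\<^bsub>M\<^esub> u"
  obtain x y z where x: "x \<in> carrier L" "y \<in> carrier L" "z \<in> carrier L"
    and a: "a = h x" "b = h y" "c = h z"
    using c unfolding b by blast
  have "x \<sqsubseteq>\<^bsub>L\<^esub> z"
  proof (rule distributiveD[OF L x])
    show "u \<sqsubseteq>\<^bsub>L\<^esub> z" if "u \<in> carrier L" "u \<sqsubseteq>\<^bsub>L\<^esub> x" "u \<sqsubseteq>\<^bsub>L\<^esub> y" for u
      using 1[of "h u"] that x le unfolding a b by blast
    show "x \<sqsubseteq>\<^bsub>L\<^esub> u" if "u \<in> carrier L" "y \<sqsubseteq>\<^bsub>L\<^esub> u" "z \<sqsubseteq>\<^bsub>L\<^esub> u" for u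
      using 2[of "h u"] that x le unfolding a b by blast
  qed
  then show "a \<sqsubseteq>\<^bsub>M\<^esub> c" using le x unfolding a by blast
qed

section \<open>Inequalities between meets and joins\<close>

locale distributive_lattice = lattice L for L :: "'u gorder" (structure) +
  assumes distributive: "distributive L"

context lattice
begin

lemma le_meet_iff:
  "\<lbrakk>x \<in> carrier L; y \<in> carrier L; z \<in> carrier L\<rbrakk> \<Longrightarrow> z \<sqsubseteq> x \<sqinter> y \<longleftrightarrow> z \<sqsubseteq> x \<and> z \<sqsubseteq> y"
  by (meson le_trans meet_closed meet_left meet_right meet_le)

lemma join_le_iff:
  "\<lbrakk>x \<in> carrier L; y \<in> carrier L; z \<in> carrier L\<rbrakk> \<Longrightarrow> x \<squnion> y \<sqsubseteq> z \<longleftrightarrow> x \<sqsubseteq> z \<and> y \<sqsubseteq> z"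
  by (meson le_trans join_closed join_left join_right join_le)

lemma meet_le_left:
  "\<lbrakk>x \<in> carrier L; y \<in> carrier L; z \<in> carrier L; x \<sqsubseteq> z\<rbrakk> \<Longrightarrow> x \<sqinter> y \<sqsubseteq> z"
  by (meson le_trans meet_closed meet_left meet_right)

lemma meet_le_right:
  "\<lbrakk>x \<in> carrier L; y \<in> carrier L; z \<in> carrier L; y \<sqsubseteq> z\<rbrakk> \<Longrightarrow> x \<sqinter> y \<sqsubseteq> z"
  by (meson le_trans meet_closed meet_left meet_right)

lemma le_join_left:
  "\<lbrakk>x \<in> carrier L; y \<in> carrier L; z \<in> carrier L; z \<sqsubseteq> x\<rbrakk> \<Longrightarrow> z \<sqsubseteq> x \<squnion> y"
  by (meson le_trans join_closed join_left join_right)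

lemma le_join_right:
  "\<lbrakk>x \<in> carrier L; y \<in> carrier L; z \<in> carrier L; z \<sqsubseteq> y\<rbrakk> \<Longrightarrow> z \<sqsubseteq> x \<squnion> y"
  by (meson le_trans join_closed join_left join_right)

text \<open>Conditional rewriting with these is a goal-directed search: meets on the right and joins
  on the left are taken apart; for a meet on the left or a join on the right, a suitable component
  is tried.\<close>

lemmas bound_simps =
  le_meet_iff join_le_iff meet_le_left meet_le_right le_join_left le_join_right

end

context distributive_lattice
begin

text \<open>As in the cut rule of sequent calculus, \<open>b\<close> stands on the left of one
  hypothesis and on the right of the other and is eliminated. Calculations inside a lattice use
  distributivity in this form.\<close>

lemma cut:
  assumes c: "a \<in> carrier L" "b \<in> carrier L" "c \<in> carrier L"
    and 1: "a \<sqinter> b \<sqsubseteq> c" and 2: "a \<sqsubseteq> b \<squnion> c"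
  shows "a \<sqsubseteq> c"
proof (rule distributiveD[OF distributive c])
  show "u \<sqsubseteq> c" if "u \<in> carrier L" "u \<sqsubseteq> a" "u \<sqsubseteq> b" for u
    using that c 1 le_trans[of u "a \<sqinter> b" c] meet_le[of u a b] by simp
  show "a \<sqsubseteq> u" if "u \<in> carrier L" "b \<sqsubseteq> u" "c \<sqsubseteq> u" for u
    using that c 2 le_trans[of a "b \<squnion> c" u] join_le[of b u c] by simp
qed

lemma join_meet_distrib_le:
  assumes "u \<in> carrier L" "v \<in> carrier L" "c \<in> carrier L"
  shows "(u \<squnion> c) \<sqinter> (v \<squnion> c) \<sqsubseteq> (u \<sqinter> v) \<squnion> c"
proof -
  let ?w = "(u \<squnion> c) \<sqinter> (v \<squnion> c)" and ?t = "(u \<sqinter> v) \<squnion> c"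
  \<comment> \<open>Cutting \<open>v\<close> from the first two gives
    \<open>?w \<sqinter> u \<sqsubseteq> ?t\<close>; cutting \<open>u\<close> from this and the
    third finishes.\<close>
  have "?w \<sqinter> u \<sqinter> v \<sqsubseteq> ?t" "?w \<sqinter> u \<sqsubseteq> v \<squnion> ?t" "?w \<sqsubseteq> u \<squnion> ?t"
    using assms by (simp_all add: bound_simps)
  then show ?thesis
    using cut[of "?w \<sqinter> u" v ?t] cut[of ?w u ?t] assms by simp
qed

end

section \<open>Distributivity of filter lattices, ideal lattices and composites\<close>

text \<open>Under reverse inclusion the goal is \<open>C \<subseteq> A\<close>. For \<open>c\<close>
  in \<open>C\<close>, the elements whose join with \<open>c\<close> lies in \<open>A\<close> form a
  filter that contains \<open>A\<close> and \<open>B\<close>, hence also \<open>C\<close> and with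
  it \<open>c\<close>.\<close>

lemma distributive_Fil:
  assumes "lattice L" "distributive L"
  shows "distributive (Fil L)"
proof -
  interpret distributive_lattice L
    using assms by (intro distributive_lattice.intro distributive_lattice_axioms.intro)
  have "C \<subseteq> A" if f: "A \<in> filters L" "B \<in> filters L" "C \<in> filters L"
    and 1: "\<And>U. U \<in> filters L \<Longrightarrow> A \<subseteq> U \<Longrightarrow> B \<subseteq> U \<Longrightarrow> C \<subseteq> U"
    and 2: "\<And>U. U \<in> filters L \<Longrightarrow> U \<subseteq> B \<Longrightarrow> U \<subseteq> C \<Longrightarrow> U \<subseteq> A" for A B C
  proof
    fix c assume c: "c \<in> C"
    then have cL: "c \<in> carrier L" using filtersD(1)[OF f(3)] by blast
    \<comment> \<open>Testing the lower bound condition on this filter alone gives \<open>c \<or> c \<in> A\<close>.\<close>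
    define U where "U = {u \<in> carrier L. u \<squnion>\<^bsub>L\<^esub> c \<in> A}"
    have AU: "A \<subseteq> U"
    proof
      fix a assume "a \<in> A"
      moreover from this have "a \<in> carrier L" using filtersD(1)[OF f(1)] by blast
      ultimately show "a \<in> U"
        using filtersD(3)[OF f(1), of a "a \<squnion>\<^bsub>L\<^esub> c"] cL by (simp add: U_def join_left)
    qed
    have BU: "B \<subseteq> U"
    proof
      fix b assume b: "b \<in> B"
      then have bL: "b \<in> carrier L" using filtersD(1)[OF f(2)] by blast
      \<comment> \<open>The principal filter of \<open>b \<squnion> c\<close> lies in both
        \<open>B\<close> and \<open>C\<close>, so the upper bound condition \<open>2\<close> places
        it inside \<open>A\<close>.\<close>
      let ?G = "{z \<in> carrier L. b \<squnion>\<^bsub>L\<^esub> c \<sqsubseteq>\<^bsub>L\<^esub> z}"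
      have G: "b \<squnion>\<^bsub>L\<^esub> c \<in> ?G" using bL cL by simp
      have "?G \<in> filters L"
      proof (rule filtersI)
        show "?G \<noteq> {}" using G by blast
        show "y \<in> ?G" if "x \<in> ?G" "y \<in> carrier L" "x \<sqsubseteq>\<^bsub>L\<^esub> y" for x y
          using that bL cL le_trans[of "b \<squnion>\<^bsub>L\<^esub> c" x y] by simp
        show "x \<sqinter>\<^bsub>L\<^esub> y \<in> ?G" if "x \<in> ?G" "y \<in> ?G" for x y
          using that bL cL by (simp add: le_meet_iff)
      qed blast
      moreover have "?G \<subseteq> B"
        using filtersD(3)[OF f(2) b] bL cL by (auto simp: join_le_iff)
      moreover have "?G \<subseteq> C"
        using filtersD(3)[OF f(3) c] bL cL by (auto simp: join_le_iff)
      ultimately have "?G \<subseteq> A" using 2 by blast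
      with G show "b \<in> U" using bL unfolding U_def by blast
    qed
    have "U \<in> filters L"
    proof (rule filtersI)
      show "U \<subseteq> carrier L" by (auto simp: U_def)
      show "U \<noteq> {}" using AU filtersD(2)[OF f(1)] by blast
      show "y \<in> U" if "x \<in> U" "y \<in> carrier L" "x \<sqsubseteq>\<^bsub>L\<^esub> y" for x y
        using filtersD(3)[OF f(1), of "x \<squnion>\<^bsub>L\<^esub> c" "y \<squnion>\<^bsub>L\<^esub> c"] that cL
        by (simp add: U_def bound_simps)
      \<comment> \<open>Here the distributivity of \<open>L\<close> enters: \<open>A\<close>
        contains the meet of \<open>x \<squnion> c\<close> and \<open>y \<squnion> c\<close>, which
        is below \<open>(x \<sqinter> y) \<squnion> c\<close>.\<close>
      show "x \<sqinter>\<^bsub>L\<^esub> y \<in> U" if "x \<in> U" "y \<in> U" for x y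
        using filtersD(4)[OF f(1), of "x \<squnion>\<^bsub>L\<^esub> c" "y \<squnion>\<^bsub>L\<^esub> c"] that cL
          join_meet_distrib_le[of x y c]
          filtersD(3)[OF f(1), of "(x \<squnion>\<^bsub>L\<^esub> c) \<sqinter>\<^bsub>L\<^esub> (y \<squnion>\<^bsub>L\<^esub> c)" "(x \<sqinter>\<^bsub>L\<^esub> y) \<squnion>\<^bsub>L\<^esub> c"]
        by (simp add: U_def)
    qed
    then have "c \<in> U" using 1 AU BU c by blast
    then show "c \<in> A"
      using filtersD(3)[OF f(1), of "c \<squnion>\<^bsub>L\<^esub> c" c] cL by (simp add: U_def join_le_iff)
  qed
  note * = this
  show ?thesis
    by (intro distributiveI, unfold Fil_def gorder.select_convs partial_object.select_convs)
      (rule *)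
qed

lemma distributive_obj:
  assumes "lattice L" "distributive L"
  shows "distributive (obj F L)"
proof (cases F)
  case FilF
  then show ?thesis using distributive_Fil[OF assms] by simp
next
  case IdlF
  show ?thesis unfolding IdlF obj.simps Idl_dual
    by (rule distributive_dual[OF distributive_Fil[OF lattice.dual_lattice[OF assms(1)]
          distributive_dual[OF assms(2)]]])
qed

lemma composite_distributive:
  assumes "composite L Fs M \<phi>" "lattice L" "distributive L"
  shows "distributive M"
  using assms
proof (induction rule: composite.induct)
  case (base M \<phi>)
  then show ?case by (blast intro: order_iso_distributive)
next
  case (step Fs M \<phi> F M' h \<psi>)
  have "distributive (obj F M)"
    using step.IH step.prems composite_lattice[OF step.hyps(1)] by (intro distributive_obj)
  with step.hyps(2) show ?case by (rule order_iso_distributive)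
qed


section \<open>Embeddings preserve binary meets\<close>

text \<open>The operation \<open>\<sqinter>\<close> is a choice of a greatest lower bound. Speaking
  of the bounds themselves makes the property compose by pure logic and fit
  \<open>order_iso_glb\<close>.\<close>

definition meet_preserving :: "'u gorder \<Rightarrow> 'v gorder \<Rightarrow> ('u \<Rightarrow> 'v) \<Rightarrow> bool" where
  "meet_preserving L M f \<longleftrightarrow> (\<forall>x\<in>carrier L. f x \<in> carrier M) \<and>
     (\<forall>x\<in>carrier L. \<forall>y\<in>carrier L. \<forall>g.
        greatest L g (Lower L {x, y}) \<longrightarrow> greatest M (f g) (Lower M {f x, f y}))"

text \<open>Serves the rule \<open>composite.step\<close>, which prescribes the new map on the
  carrier only; greatest lower bounds lie there too.\<close>

lemma meet_preserving_cong:
  assumes "\<And>x. x \<in> carrier L \<Longrightarrow> f x = g x" "meet_preserving L M g"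
  shows "meet_preserving L M f"
proof -
  have "greatest M (f z) (Lower M {f x, f y})"
    if "x \<in> carrier L" "y \<in> carrier L" and z: "greatest L z (Lower L {x, y})" for x y z
  proof -
    have "z \<in> carrier L" using z unfolding greatest_def Lower_def by blast
    then show ?thesis using that assms unfolding meet_preserving_def by simp
  qed
  then show ?thesis using assms unfolding meet_preserving_def by simp
qed

lemma meet_preserving_comp:
  "meet_preserving L M f \<Longrightarrow> meet_preserving M N g \<Longrightarrow> meet_preserving L N (\<lambda>x. g (f x))"
  unfolding meet_preserving_def by blast

lemma meet_preserving_order_iso: "order_iso L M h \<Longrightarrow> meet_preserving L M h"
  unfolding meet_preserving_def using order_iso_glb[of L M h]
  by (simp add: order_iso_def bij_betw_def) blast

text \<open>A filter containing \<open>Fg L x\<close> and \<open>Fg L y\<close> contains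
  \<open>x \<sqinter> y\<close>, hence the greatest lower bound \<open>g\<close> and all of
  \<open>Fg L g\<close>. For ideals, the members common to \<open>Ig L x\<close> and
  \<open>Ig L y\<close> are the common lower bounds of \<open>x\<close> and \<open>y\<close>, so
  they are below \<open>g\<close>.\<close>

lemma meet_preserving_emb:
  assumes "lattice L"
  shows "meet_preserving L (obj F L) (emb F L)"
proof -
  interpret lattice L by fact
  have c: "emb F L x \<in> carrier (obj F L)" if "x \<in> carrier L" for x
  proof (cases F)
    case FilF
    have "Fg L x \<in> filters L"
    proof (rule filtersI)
      show "Fg L x \<noteq> {}" using that le_refl unfolding Fg_def by blast
      show "z \<in> Fg L x" if "y \<in> Fg L x" "z \<in> carrier L" "y \<sqsubseteq>\<^bsub>L\<^esub> z" for y z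
        using that \<open>x \<in> carrier L\<close> le_trans[of x y z] unfolding Fg_def by blast
      show "y \<sqinter>\<^bsub>L\<^esub> z \<in> Fg L x" if "y \<in> Fg L x" "z \<in> Fg L x" for y z
        using that \<open>x \<in> carrier L\<close> by (simp add: Fg_def le_meet_iff)
    qed (simp add: Fg_def)
    then show ?thesis by (simp add: FilF Fil_def)
  next
    case IdlF
    have "Ig L x \<subseteq> carrier L" unfolding Ig_def by blast
    moreover have "Ig L x \<noteq> {}" using that le_refl unfolding Ig_def by blast
    moreover have "z \<in> Ig L x" if "y \<in> Ig L x" "z \<in> carrier L" "z \<sqsubseteq>\<^bsub>L\<^esub> y" for y z
      using that \<open>x \<in> carrier L\<close> le_trans[of z y x] unfolding Ig_def by blast
    moreover have "y \<squnion>\<^bsub>L\<^esub> z \<in> Ig L x" if "y \<in> Ig L x" "z \<in> Ig L x" for y z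
      using that \<open>x \<in> carrier L\<close> by (simp add: Ig_def join_le_iff)
    ultimately have "Ig L x \<in> ideals L" unfolding ideals_def by blast
    then show ?thesis by (simp add: IdlF Idl_def)
  qed
  have "greatest (obj F L) (emb F L g) (Lower (obj F L) {emb F L x, emb F L y})"
    if xy: "x \<in> carrier L" "y \<in> carrier L" and g: "greatest L g (Lower L {x, y})" for x y g
  proof -
    have gL: "g \<in> carrier L" and gx: "g \<sqsubseteq>\<^bsub>L\<^esub> x" "g \<sqsubseteq>\<^bsub>L\<^esub> y"
      and gr: "\<And>u. u \<in> carrier L \<Longrightarrow> u \<sqsubseteq>\<^bsub>L\<^esub> x \<Longrightarrow> u \<sqsubseteq>\<^bsub>L\<^esub> y \<Longrightarrow> u \<sqsubseteq>\<^bsub>L\<^esub> g"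
      using g xy unfolding greatest_def Lower_def by auto
    show ?thesis
    proof (cases F)
      case FilF
      have "Fg L g \<subseteq> U" if U: "U \<in> filters L" "Fg L x \<subseteq> U" "Fg L y \<subseteq> U" for U
      proof -
        have "x \<sqinter>\<^bsub>L\<^esub> y \<in> U" using U(2,3) xy filtersD(4)[OF U(1)] by (auto simp: Fg_def)
        moreover have "x \<sqinter>\<^bsub>L\<^esub> y \<sqsubseteq>\<^bsub>L\<^esub> g" using gr xy meet_left meet_right by simp
        ultimately have "g \<in> U" using filtersD(3)[OF U(1)] gL by blast
        then show ?thesis using filtersD(3)[OF U(1)] by (auto simp: Fg_def)
      qed
      moreover have "Fg L x \<subseteq> Fg L g" "Fg L y \<subseteq> Fg L g"
        using xy gL le_trans[OF gx(1)] le_trans[OF gx(2)] unfolding Fg_def by blast+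
      ultimately show ?thesis
        using c[OF gL] c[OF xy(1)] c[OF xy(2)] FilF unfolding greatest_def Lower_def
        by (auto simp: Fil_def)
    next
      case IdlF
      have "U \<subseteq> Ig L g" if "U \<subseteq> Ig L x" "U \<subseteq> Ig L y" for U
      proof
        fix u assume "u \<in> U"
        then show "u \<in> Ig L g" using that gr[of u] gL by (simp add: Ig_def subset_iff)
      qed
      moreover have "Ig L g \<subseteq> Ig L x" "Ig L g \<subseteq> Ig L y"
        using xy gL le_trans[OF _ gx(1)] le_trans[OF _ gx(2)] unfolding Ig_def by blast+
      ultimately show ?thesis
        using c[OF gL] c[OF xy(1)] c[OF xy(2)] IdlF unfolding greatest_def Lower_def
        by (auto simp: Idl_def)
    qed
  qed
  with c show ?thesis unfolding meet_preserving_def by blast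
qed

lemma composite_meet_preserving:
  assumes "composite L Fs M \<phi>" "lattice L"
  shows "meet_preserving L M \<phi>"
  using assms
proof (induction rule: composite.induct)
  case (base M \<phi>)
  then show ?case by (blast intro: meet_preserving_order_iso)
next
  case (step Fs M \<phi> F M' h \<psi>)
  have "meet_preserving L M' (\<lambda>x. h (emb F M (\<phi> x)))"
    using meet_preserving_comp[OF meet_preserving_comp[OF step.IH[OF step.prems]
        meet_preserving_emb[OF composite_lattice[OF step.hyps(1) step.prems]]]
      meet_preserving_order_iso[OF step.hyps(2)]] .
  with step.hyps(3) show ?case by (rule meet_preserving_cong)
qed

lemma meet_preservingD:
  assumes f: "meet_preserving L M f" and "lattice L" "lattice M" and x: "x \<in> carrier L" "y \<in> carrier L"
  shows "f (x \<sqinter>\<^bsub>L\<^esub> y) = f x \<sqinter>\<^bsub>M\<^esub> f y"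
proof -
  interpret L: lattice L by fact
  interpret M: lattice M by fact
  have "greatest L (x \<sqinter>\<^bsub>L\<^esub> y) (Lower L {x, y})"
    unfolding meet_def using L.inf_of_two_greatest x by blast
  then have "greatest M (f (x \<sqinter>\<^bsub>L\<^esub> y)) (Lower M {f x, f y})"
    using f x unfolding meet_preserving_def by blast
  moreover have "greatest M (f x \<sqinter>\<^bsub>M\<^esub> f y) (Lower M {f x, f y})"
    unfolding meet_def using M.inf_of_two_greatest f x by (simp add: meet_preserving_def)
  ultimately show ?thesis by (rule M.greatest_unique)
qed

text \<open>\<open>x\<close> is below \<open>y\<close> exactly if it is a greatest lower bound of
  the two.\<close>

lemma meet_preserving_mono:
  assumes f: "meet_preserving L M f" and "lattice L"
    and x: "x \<in> carrier L" "y \<in> carrier L" "x \<sqsubseteq>\<^bsub>L\<^esub> y"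
  shows "f x \<sqsubseteq>\<^bsub>M\<^esub> f y"
proof -
  interpret L: lattice L by fact
  have "greatest L x (Lower L {x, y})"
    using x L.le_refl[OF x(1)] unfolding greatest_def Lower_def by blast
  then have "greatest M (f x) (Lower M {f x, f y})" using f x unfolding meet_preserving_def by blast
  moreover have "f x \<in> carrier M" "f y \<in> carrier M" using f x unfolding meet_preserving_def by blast+
  ultimately show ?thesis unfolding greatest_def Lower_def by blast
qed


section \<open>Steps in distributive lattices\<close>

lemma (in distributive_lattice) covering_iff:
  "covering L (x, y) \<longleftrightarrow> x \<in> carrier L \<and> y \<in> carrier L \<and> x \<sqsubseteq> y \<and> x \<noteq> y \<and>
     (\<forall>z\<in>carrier L. x \<sqsubseteq> z \<and> z \<sqsubseteq> y \<longrightarrow> z = x \<or> z = y)"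
  by (auto simp: covering_def lless_eq)

text \<open>The two equations of a transposition are split into inequalities, which suit
  \<open>bound_simps\<close>.\<close>

lemma (in distributive_lattice) nearrowI:
  assumes "x \<in> carrier L" "y \<in> carrier L" "z \<in> carrier L" "w \<in> carrier L"
    "x \<sqsubseteq> y" "z \<sqsubseteq> w" "x \<sqsubseteq> z" "y \<sqsubseteq> w" "y \<sqinter> z \<sqsubseteq> x" "w \<sqsubseteq> y \<squnion> z"
  shows "((x, y), (z, w)) \<in> nearrow L"
  using assms by (auto simp: nearrow_def bound_simps intro!: le_antisym)

text \<open>Transposed intervals correspond under \<open>u \<mapsto> y \<sqinter> u\<close> and
  \<open>u \<mapsto> u \<squnion> z\<close>. The image of an intermediate element must be an
  endpoint of the covering, and then so is the element itself, in one of the two cases by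
  \<open>cut\<close>.\<close>

lemma (in distributive_lattice) nearrow_covering:
  assumes n: "((x, y), (z, w)) \<in> nearrow L"
  shows "covering L (x, y) \<longleftrightarrow> covering L (z, w)"
proof
  have c: "x \<in> carrier L" "y \<in> carrier L" "z \<in> carrier L" "w \<in> carrier L"
    and le: "x \<sqsubseteq> y" "z \<sqsubseteq> w" and x: "y \<sqinter> z = x" and w: "y \<squnion> z = w"
    using n by (simp_all add: nearrow_def)
  have xz: "x \<sqsubseteq> z" and yw: "y \<sqsubseteq> w" using c by (simp_all flip: x w add: meet_right join_left)
  {
    assume cov: "covering L (x, y)"
    have "z \<noteq> w"
    proof
      assume "z = w"
      then have "y \<sqsubseteq> x" using yw c by (simp flip: x add: le_meet_iff)
      then show False using cov le c le_antisym by (auto simp: covering_iff)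
    qed
    moreover have "u = z \<or> u = w" if u: "u \<in> carrier L" "z \<sqsubseteq> u" "u \<sqsubseteq> w" for u
    proof -
      have "x \<sqsubseteq> u" using le_trans[OF xz u(2)] c u by simp
      then have "x \<sqsubseteq> y \<sqinter> u" "y \<sqinter> u \<sqsubseteq> y" using c u le by (simp_all add: bound_simps)
      then have "y \<sqinter> u = x \<or> y \<sqinter> u = y" using cov c u by (simp add: covering_iff)
      then show ?thesis
      proof
        assume "y \<sqinter> u = x"
        then have "u \<sqinter> y \<sqsubseteq> z" using xz by (simp add: meet_comm)
        then have "u \<sqsubseteq> z" using cut[of u y z] c u w by simp
        then show ?thesis using u c le_antisym by simp
      next
        assume "y \<sqinter> u = y"
        then have "y \<sqsubseteq> u" using meet_right[of y u] c u by simp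
        then have "w \<sqsubseteq> u" using u c by (simp flip: w add: join_le_iff)
        then show ?thesis using u c le_antisym by simp
      qed
    qed
    ultimately show "covering L (z, w)" using c le by (simp add: covering_iff)
  next
    assume cov: "covering L (z, w)"
    have "x \<noteq> y"
    proof
      assume "x = y"
      then have "w \<sqsubseteq> z" using xz c by (simp flip: w add: join_le_iff)
      then show False using cov le c le_antisym by (auto simp: covering_iff)
    qed
    moreover have "u = x \<or> u = y" if u: "u \<in> carrier L" "x \<sqsubseteq> u" "u \<sqsubseteq> y" for u
    proof -
      have "u \<sqsubseteq> w" using le_trans[OF u(3) yw] c u by simp
      then have "z \<sqsubseteq> u \<squnion> z" "u \<squnion> z \<sqsubseteq> w" using c u le by (simp_all add: bound_simps)
      then have "u \<squnion> z = z \<or> u \<squnion> z = w" using cov c u by (simp add: covering_iff)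
      then show ?thesis
      proof
        assume "u \<squnion> z = z"
        then have "u \<sqsubseteq> z" using join_left[of u z] c u by simp
        then have "u \<sqsubseteq> x" using u c by (simp flip: x add: le_meet_iff)
        then show ?thesis using u c le_antisym by simp
      next
        assume "u \<squnion> z = w"
        then have "y \<sqsubseteq> z \<squnion> u" using yw by (simp add: join_comm)
        moreover have "y \<sqinter> z \<sqsubseteq> u" using x u by simp
        ultimately have "y \<sqsubseteq> u" using cut[of y z u] c u by simp
        then show ?thesis using u c le_antisym by simp
      qed
    qed
    ultimately show "covering L (x, y)" using c le by (simp add: covering_iff)
  }
qed

section \<open>Steps along transpositions and in intervals\<close>

lemma steps_covering: "s \<in> steps L \<Longrightarrow> d \<in> s \<Longrightarrow> covering L d"
  unfolding steps_def by auto

text \<open>Steps can be followed along transpositions both ways: one more pair extends the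
  transitive closure, and coverings go to coverings.\<close>

lemma (in distributive_lattice) steps_nearrow:
  assumes "s \<in> steps L"
    and n: "((x, y), (z, w)) \<in> nearrow L"
  shows "(x, y) \<in> s \<longleftrightarrow> (z, w) \<in> s"
proof -
  obtain c where s: "s = {d. covering L d \<and> (c, d) \<in> projective L}"
    using assms(1) unfolding steps_def by blast
  have "(c, (x, y)) \<in> projective L \<longleftrightarrow> (c, (z, w)) \<in> projective L"
    using n unfolding projective_def by (meson UnI1 UnI2 converseI trancl.trancl_into_trancl)
  then show ?thesis using nearrow_covering[OF n] by (simp add: s)
qed

text \<open>Hausdorff's principle is applied to the elements comparable with all of
  \<open>B\<close>. A maximal chain there absorbs \<open>B\<close>, and it is maximal in
  \<open>A\<close> because any larger chain contains \<open>B\<close> and so consists of such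
  elements.\<close>

lemma maxchain_through:
  assumes "B \<subseteq> A" and B: "pred_on.chain A R B"
  shows "\<exists>C. pred_on.maxchain A R C \<and> B \<subseteq> C"
proof -
  let ?A = "{z \<in> A. \<forall>b\<in>B. R\<^sup>=\<^sup>= z b \<or> R\<^sup>=\<^sup>= b z}"
  obtain C where C: "pred_on.maxchain ?A R C" using pred_on.Hausdorff[of ?A R] by blast
  have ch: "C \<subseteq> ?A" "\<forall>x\<in>C. \<forall>y\<in>C. R\<^sup>=\<^sup>= x y \<or> R\<^sup>=\<^sup>= y x"
    using C unfolding pred_on.maxchain_def pred_on.chain_def by auto
  have "B \<subseteq> ?A" "\<forall>x\<in>B. \<forall>y\<in>B. R\<^sup>=\<^sup>= x y \<or> R\<^sup>=\<^sup>= y x"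
    using B unfolding pred_on.chain_def by auto
  with ch have "pred_on.chain ?A R (C \<union> B)"
    unfolding pred_on.chain_def by blast
  then have BC: "B \<subseteq> C" using C unfolding pred_on.maxchain_def by blast
  moreover have "\<not> C \<subset> D" if D: "pred_on.chain A R D" for D
  proof
    assume "C \<subset> D"
    moreover from this have "pred_on.chain ?A R D"
      using D BC unfolding pred_on.chain_def by blast
    ultimately show False using C unfolding pred_on.maxchain_def by blast
  qed
  moreover have "pred_on.chain A R C" using ch unfolding pred_on.chain_def by blast
  ultimately show ?thesis unfolding pred_on.maxchain_def by blast
qed

text \<open>Replaces maximal chains by single coverings: the two ends of a covering inside the
  interval form a chain, which extends to a maximal one.\<close>

lemma (in distributive_lattice) steps_in_iff:
  assumes ab: "a \<in> carrier L" "b \<in> carrier L"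
  shows "s \<in> steps_in L a b \<longleftrightarrow> s \<in> steps L \<and> (\<exists>(x, y)\<in>s. a \<sqsubseteq> x \<and> y \<sqsubseteq> b)"
proof -
  have 1: "\<exists>C. pred_on.maxchain \<lbrace>a..b\<rbrace> (\<sqsubseteq>) C \<and> x \<in> C \<and> y \<in> C"
    if "covering L (x, y)" "a \<sqsubseteq> x" "y \<sqsubseteq> b" for x y
  proof -
    have xy: "x \<in> carrier L" "y \<in> carrier L" "x \<sqsubseteq> y" using that by (simp_all add: covering_iff)
    then have "a \<sqsubseteq> y" "x \<sqsubseteq> b"
      using that ab le_trans[of a x y] le_trans[of x y b] by blast+
    then have "{x, y} \<subseteq> \<lbrace>a..b\<rbrace>" using that xy unfolding at_least_at_most_def by blast
    moreover from this have "pred_on.chain \<lbrace>a..b\<rbrace> (\<sqsubseteq>) {x, y}"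
      using xy(3) unfolding pred_on.chain_def by blast
    ultimately show ?thesis using maxchain_through[of "{x, y}" "\<lbrace>a..b\<rbrace>" "(\<sqsubseteq>)"] by blast
  qed
  have 2: "a \<sqsubseteq> x" "x \<sqsubseteq> b" if "pred_on.maxchain \<lbrace>a..b\<rbrace> (\<sqsubseteq>) C" "x \<in> C" for C x
  proof -
    have "C \<subseteq> \<lbrace>a..b\<rbrace>" using that(1) unfolding pred_on.maxchain_def pred_on.chain_def by (elim conjE)
    then show "a \<sqsubseteq> x" "x \<sqsubseteq> b" using that(2) unfolding at_least_at_most_def by blast+
  qed
  show ?thesis
  proof
    assume "s \<in> steps_in L a b"
    then obtain C x y where "s \<in> steps L" "pred_on.maxchain \<lbrace>a..b\<rbrace> (\<sqsubseteq>) C"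
      "(x, y) \<in> s" "x \<in> C" "y \<in> C"
      unfolding steps_in_def by blast
    moreover from this have "a \<sqsubseteq> x" "y \<sqsubseteq> b" using 2 by metis+
    ultimately show "s \<in> steps L \<and> (\<exists>(x, y)\<in>s. a \<sqsubseteq> x \<and> y \<sqsubseteq> b)" by blast
  next
    assume "s \<in> steps L \<and> (\<exists>(x, y)\<in>s. a \<sqsubseteq> x \<and> y \<sqsubseteq> b)"
    then obtain x y where *: "s \<in> steps L" "(x, y) \<in> s" "a \<sqsubseteq> x" "y \<sqsubseteq> b" by blast
    then obtain C where "pred_on.maxchain \<lbrace>a..b\<rbrace> (\<sqsubseteq>) C" "x \<in> C" "y \<in> C"
      using 1[OF steps_covering] by metis
    with * show "s \<in> steps_in L a b" unfolding steps_in_def by blast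
  qed
qed

text \<open>The element \<open>y \<sqinter> (x \<squnion> m)\<close> is between \<open>x\<close> and
  \<open>y\<close>, so it is one of them. If it is \<open>x\<close>, joining with \<open>m\<close>
  transposes the covering; if it is \<open>y\<close>, meeting with \<open>m\<close> does.\<close>

lemma (in distributive_lattice) steps_in_split:
  assumes c: "a \<in> carrier L" "m \<in> carrier L" "b \<in> carrier L"
    and le: "a \<sqsubseteq> m" "m \<sqsubseteq> b" and s: "s \<in> steps_in L a b"
  shows "s \<in> steps_in L a m \<or> s \<in> steps_in L m b"
proof -
  obtain x y where sS: "s \<in> steps L" and xys: "(x, y) \<in> s" "a \<sqsubseteq> x" "y \<sqsubseteq> b"
    using s c by (auto simp: steps_in_iff)
  have cov: "covering L (x, y)" using sS xys(1) by (rule steps_covering)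
  then have xy: "x \<in> carrier L" "y \<in> carrier L" "x \<sqsubseteq> y" by (simp_all add: covering_iff)
  have "x \<sqsubseteq> y \<sqinter> (x \<squnion> m)" "y \<sqinter> (x \<squnion> m) \<sqsubseteq> y" using xy c by (simp_all add: bound_simps)
  then have "y \<sqinter> (x \<squnion> m) = x \<or> y \<sqinter> (x \<squnion> m) = y" using cov xy c by (simp add: covering_iff)
  then show ?thesis
  proof
    assume e: "y \<sqinter> (x \<squnion> m) = x"
    have "((x, y), (x \<squnion> m, y \<squnion> m)) \<in> nearrow L"
      using xy c by (intro nearrowI) (simp_all add: e bound_simps)
    then have "(x \<squnion> m, y \<squnion> m) \<in> s" using steps_nearrow[OF sS] xys(1) by blast
    moreover have "m \<sqsubseteq> x \<squnion> m" "y \<squnion> m \<sqsubseteq> b" using xy c xys le by (simp_all add: bound_simps)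
    ultimately show ?thesis using sS c by (auto simp: steps_in_iff)
  next
    assume "y \<sqinter> (x \<squnion> m) = y"
    \<comment> \<open>Cutting \<open>m\<close> turns this into
      \<open>y \<sqsubseteq> (y \<sqinter> m) \<squnion> x\<close>, the join half of the
      transposition from the meets with \<open>m\<close>.\<close>
    then have "y \<sqsubseteq> x \<squnion> m" using meet_right[of y "x \<squnion> m"] xy c by simp
    moreover have "x \<squnion> m \<sqsubseteq> m \<squnion> ((y \<sqinter> m) \<squnion> x)" using xy c by (simp add: bound_simps)
    ultimately have "y \<sqsubseteq> m \<squnion> ((y \<sqinter> m) \<squnion> x)"
      using le_trans[of y "x \<squnion> m" "m \<squnion> ((y \<sqinter> m) \<squnion> x)"] xy c by simp
    moreover have "y \<sqinter> m \<sqsubseteq> (y \<sqinter> m) \<squnion> x" using xy c by (simp add: join_left)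
    ultimately have e: "y \<sqsubseteq> (y \<sqinter> m) \<squnion> x" using cut[of y m "(y \<sqinter> m) \<squnion> x"] xy c by simp
    have "((x \<sqinter> m, y \<sqinter> m), (x, y)) \<in> nearrow L"
      using xy c e by (intro nearrowI) (simp_all add: bound_simps)
    then have "(x \<sqinter> m, y \<sqinter> m) \<in> s" using steps_nearrow[OF sS] xys(1) by blast
    moreover have "a \<sqsubseteq> x \<sqinter> m" "y \<sqinter> m \<sqsubseteq> m" using xy c xys le by (simp_all add: bound_simps)
    ultimately show ?thesis using sS c by (auto simp: steps_in_iff)
  qed
qed

lemma (in distributive_lattice) steps_in_mono:
  assumes "a \<in> carrier L" "b \<in> carrier L" "a' \<in> carrier L" "b' \<in> carrier L" "a' \<sqsubseteq> a" "b \<sqsubseteq> b'"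
  shows "steps_in L a b \<subseteq> steps_in L a' b'"
proof
  fix s assume "s \<in> steps_in L a b"
  then obtain x y where "s \<in> steps L" "(x, y) \<in> s" "a \<sqsubseteq> x" "y \<sqsubseteq> b"
    using assms by (auto simp: steps_in_iff)
  moreover from this have "x \<in> carrier L" "y \<in> carrier L"
    using steps_covering[of s L "(x, y)"] by (simp_all add: covering_iff)
  ultimately have "a' \<sqsubseteq> x" "y \<sqsubseteq> b'"
    using assms le_trans[of a' a x] le_trans[of y b b'] by simp_all
  then show "s \<in> steps_in L a' b'"
    using \<open>s \<in> steps L\<close> \<open>(x, y) \<in> s\<close> assms by (auto simp: steps_in_iff)
qed

text \<open>For a covering in the lower interval,
  \<open>y \<sqinter> z \<sqsubseteq> b \<sqinter> z \<sqsubseteq> x\<close>; hence joining with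
  \<open>z\<close> transposes it up.\<close>

lemma (in distributive_lattice) steps_in_transpose_up:
  assumes c: "b \<in> carrier L" "z \<in> carrier L"
  shows "steps_in L (b \<sqinter> z) b \<subseteq> steps_in L z (b \<squnion> z)"
proof
  fix s assume "s \<in> steps_in L (b \<sqinter> z) b"
  then obtain x y where sS: "s \<in> steps L" and xys: "(x, y) \<in> s" "b \<sqinter> z \<sqsubseteq> x" "y \<sqsubseteq> b"
    using c by (auto simp: steps_in_iff)
  have xy: "x \<in> carrier L" "y \<in> carrier L" "x \<sqsubseteq> y"
    using steps_covering[OF sS xys(1)] by (simp_all add: covering_iff)
  have "y \<sqinter> z \<sqsubseteq> b \<sqinter> z" using xy c xys by (simp add: bound_simps)
  then have yz: "y \<sqinter> z \<sqsubseteq> x" using le_trans[of "y \<sqinter> z" "b \<sqinter> z" x] xys xy c by simp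
  \<comment> \<open>The meet half of the transposition,
    \<open>y \<sqinter> (x \<squnion> z) \<sqsubseteq> x\<close>, is obtained by cutting
    \<open>z\<close>.\<close>
  have "y \<sqinter> (x \<squnion> z) \<sqinter> z \<sqsubseteq> y \<sqinter> z" using xy c by (simp add: bound_simps)
  then have "y \<sqinter> (x \<squnion> z) \<sqinter> z \<sqsubseteq> x"
    using yz le_trans[of "y \<sqinter> (x \<squnion> z) \<sqinter> z" "y \<sqinter> z" x] xy c by simp
  moreover have "y \<sqinter> (x \<squnion> z) \<sqsubseteq> z \<squnion> x"
    using xy c meet_right[of y "x \<squnion> z"] by (simp add: join_comm)
  ultimately have "y \<sqinter> (x \<squnion> z) \<sqsubseteq> x"
    using cut[of "y \<sqinter> (x \<squnion> z)" z x] xy c by simp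
  then have "((x, y), (x \<squnion> z, y \<squnion> z)) \<in> nearrow L"
    using xy c by (intro nearrowI) (simp_all add: bound_simps)
  then have "(x \<squnion> z, y \<squnion> z) \<in> s" using steps_nearrow[OF sS] xys(1) by blast
  moreover have "z \<sqsubseteq> x \<squnion> z" "y \<squnion> z \<sqsubseteq> b \<squnion> z" using xy c xys by (simp_all add: bound_simps)
  ultimately show "s \<in> steps_in L z (b \<squnion> z)" using sS c by (auto simp: steps_in_iff)
qed

lemma (in distributive_lattice) steps_in_refl: "a \<in> carrier L \<Longrightarrow> steps_in L a a = {}"
proof -
  assume a: "a \<in> carrier L"
  have False if s: "s \<in> steps L" and xy: "(x, y) \<in> s" "a \<sqsubseteq> x" "y \<sqsubseteq> a" for s x y
  proof -
    have "x \<in> carrier L" "y \<in> carrier L" "x \<sqsubseteq> y" "x \<noteq> y"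
      using steps_covering[OF s xy(1)] by (simp_all add: covering_iff)
    then show False using xy a le_trans[of y a x] le_antisym by blast
  qed
  then show ?thesis using a by (auto simp: steps_in_iff)
qed


section \<open>Proofs cover steps\<close>

lemma meet_ba: "x \<sqinter>\<^bsub>ba\<^esub> y = Lattices.inf x y"
proof -
  interpret lattice "ba :: 'a gorder" by (rule lattice_ba)
  have "greatest ba (x \<sqinter>\<^bsub>ba\<^esub> y) (Lower ba {x, y})"
    unfolding meet_def using inf_of_two_greatest by (simp add: ba_def)
  moreover have "greatest ba (Lattices.inf x y) (Lower ba {x, y})"
    by (simp add: ba_def greatest_def Lower_def)
  ultimately show ?thesis by (rule greatest_unique)
qed

lemma inf_ba:
  assumes "greatest ba g (Lower ba S)"
  shows "\<Sqinter>\<^bsub>ba\<^esub>S = g"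
proof -
  interpret lattice "ba :: 'a gorder" by (rule lattice_ba)
  show ?thesis
    unfolding inf_def using assms by (metis (no_types, lifting) greatest_unique someI_ex)
qed

lemma inf_ba_empty: "\<Sqinter>\<^bsub>ba\<^esub>{} = Orderings.top"
  by (rule inf_ba) (simp add: ba_def greatest_def Lower_def)

text \<open>Infinite sets need not have a greatest lower bound here, so existence is first shown by
  induction on the finite set.\<close>

lemma inf_ba_insert:
  assumes "finite S"
  shows "\<Sqinter>\<^bsub>ba\<^esub>(insert p S) = Lattices.inf p (\<Sqinter>\<^bsub>ba\<^esub>S)"
proof -
  have "\<exists>g. greatest ba g (Lower ba S)" using assms
  proof (induction S)
    case empty
    have "greatest ba Orderings.top (Lower ba {})" by (simp add: ba_def greatest_def Lower_def)
    then show ?case ..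
  next
    case (insert q S)
    then obtain g where "greatest ba g (Lower ba S)" by blast
    then have "greatest ba (Lattices.inf q g) (Lower ba (insert q S))"
      by (auto simp: ba_def greatest_def Lower_def le_infI2)
    then show ?case ..
  qed
  then obtain g where g: "greatest ba g (Lower ba S)" by blast
  then have "greatest ba (Lattices.inf p g) (Lower ba (insert p S))"
    by (auto simp: ba_def greatest_def Lower_def le_infI2)
  then show ?thesis using g by (simp add: inf_ba)
qed

theorem theorem35:
  fixes Rs :: "'a::boolean_algebra inst set set"
    and T :: "'a set" and P :: 'a and Ns :: "'a inst list"
    and Fs :: "ffun list" and M :: "'u gorder" and \<phi> :: "'a set \<Rightarrow> 'u"
  assumes "calculus Rs"
    and "T \<in> filters ba"
    and "composite (Fil ba) Fs M \<phi>"
    and "is_proof Rs T Ns P"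
  shows "covers M \<phi> (set Ns) (steps_of_proof M \<phi> T P)"
proof -
  have FL: "lattice (Fil (ba :: 'a gorder))" by (rule lattice_Fil[OF lattice_ba])
  have lM: "lattice M" using composite_lattice[OF assms(3) FL] .
  have "distributive M"
    using composite_distributive[OF assms(3) FL distributive_Fil[OF lattice_ba distributive_ba]] .
  with lM interpret M: distributive_lattice M
    by (intro distributive_lattice.intro distributive_lattice_axioms.intro)
  have mp: "meet_preserving (Fil ba) M \<phi>"
    using composite_meet_preserving[OF assms(3) FL] .
  define \<psi> where "\<psi> p = \<phi> (Fg ba p)" for p
  have mF: "meet_preserving ba (Fil ba) (Fg (ba :: 'a gorder))"
    using meet_preserving_emb[OF lattice_ba, of FilF] by simp
  have m\<psi>: "meet_preserving ba M \<psi>"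
    unfolding \<psi>_def by (rule meet_preserving_comp[OF mF mp])
  have \<psi>c [simp]: "\<psi> p \<in> carrier M" for p
    using m\<psi> by (simp add: meet_preserving_def ba_def)
  have \<psi>m: "\<psi> (Lattices.inf p q) = \<psi> p \<sqinter>\<^bsub>M\<^esub> \<psi> q" for p q
    using meet_preservingD[OF m\<psi> lattice_ba lM, of p q] by (simp add: meet_ba) (simp add: ba_def)
  have \<phi>T [simp]: "\<phi> T \<in> carrier M"
    using mp assms(2) by (simp add: meet_preserving_def Fil_def)
  \<comment> \<open>Membership of \<open>p\<close> in \<open>T\<close> means
    \<open>Fg ba p \<subseteq> T\<close>, that is, \<open>T\<close> is below \<open>Fg ba p\<close>
    in the reversed order.\<close>
  have T: "\<phi> T \<sqsubseteq>\<^bsub>M\<^esub> \<psi> p" if "p \<in> T" for p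
  proof -
    have "Fg ba p \<in> filters ba" using mF by (simp add: meet_preserving_def ba_def Fil_def)
    moreover have "Fg ba p \<subseteq> T" using filtersD(3)[OF assms(2) that] by (auto simp: Fg_def)
    ultimately show ?thesis
      unfolding \<psi>_def using assms(2)
      by (intro meet_preserving_mono[OF mp FL]) (simp_all add: Fil_def)
  qed
  \<comment> \<open>For instances without premises, whose meet of premises is the top
    element.\<close>
  have top: "Orderings.top \<in> T"
    using filtersD(2,3)[OF assms(2)] by (auto simp: ba_def)
  have below_premises: "a \<sqsubseteq>\<^bsub>M\<^esub> \<psi> (\<Sqinter>\<^bsub>ba\<^esub>S)"
    if "finite S" "a \<in> carrier M" "a \<sqsubseteq>\<^bsub>M\<^esub> \<phi> T" "\<forall>p\<in>S. a \<sqsubseteq>\<^bsub>M\<^esub> \<psi> p" for a S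
    using that
  proof (induction S)
    case empty
    then show ?case using M.le_trans[OF _ T[OF top], of a] by (simp add: inf_ba_empty)
  next
    case (insert p S)
    then show ?case by (simp add: inf_ba_insert \<psi>m M.le_meet_iff)
  qed
  \<comment> \<open>\<open>a i\<close> takes in the conclusions with index below \<open>i\<close>,
    so the link from \<open>a (Suc i)\<close> to \<open>a i\<close> belongs to instance
    \<open>i\<close>. The chain is used up to \<open>length Ns\<close> only.\<close>
  define a where "a = rec_nat (\<phi> T) (\<lambda>i u. u \<sqinter>\<^bsub>M\<^esub> \<psi> (snd (Ns ! i)))"
  have a0: "a 0 = \<phi> T" and aS: "a (Suc i) = a i \<sqinter>\<^bsub>M\<^esub> \<psi> (snd (Ns ! i))" for i
    by (simp_all add: a_def)
  have ac [simp]: "a i \<in> carrier M" for i by (induction i) (simp_all add: a0 aS)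
  have aT: "a i \<sqsubseteq>\<^bsub>M\<^esub> \<phi> T" for i by (induction i) (simp_all add: a0 aS M.meet_le_left)
  have a\<psi>: "a i \<sqsubseteq>\<^bsub>M\<^esub> \<psi> (snd (Ns ! j))" if "j < i" for i j
    using that by (induction i) (auto simp: aS less_Suc_eq M.meet_le_left M.meet_right)
  \<comment> \<open>The hypothesis matches \<open>is_proof\<close> twice: for a premise of instance
    \<open>i\<close>, and for \<open>P\<close> with \<open>i = length Ns\<close>.\<close>
  have a_le: "a i \<sqsubseteq>\<^bsub>M\<^esub> \<psi> p" if "p \<in> T \<or> (\<exists>j<i. p = snd (Ns ! j))" for i p
    using that M.le_trans[OF aT T, of p i] a\<psi> by auto
  have link: "steps_in M (a (Suc i)) (a i) \<subseteq> steps_of_inst M \<phi> (Ns ! i)" if i: "i < length Ns" for i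
  proof -
    obtain S Q where N: "Ns ! i = (S, Q)" by fastforce
    have "(S, Q) \<in> \<Union>Rs" and S: "\<forall>p\<in>S. p \<in> T \<or> (\<exists>j<i. p = snd (Ns ! j))"
      using assms(4) i N unfolding is_proof_def by (metis, metis fst_conv)
    then have "finite S" using assms(1) unfolding calculus_def by blast
    let ?b = "\<psi> (\<Sqinter>\<^bsub>ba\<^esub>S)"
    let ?z = "\<psi> Q \<sqinter>\<^bsub>M\<^esub> ?b"
    have ab: "a i \<sqsubseteq>\<^bsub>M\<^esub> ?b"
    proof (rule below_premises[OF \<open>finite S\<close> ac aT], rule ballI)
      show "a i \<sqsubseteq>\<^bsub>M\<^esub> \<psi> p" if "p \<in> S" for p using S that by (intro a_le) (rule bspec)
    qed
    \<comment> \<open>The interval of the instance runs from \<open>?z\<close> to \<open>?b\<close>.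
      As \<open>a i\<close> is below \<open>?b\<close>, meeting it with \<open>?z\<close> or with
      \<open>\<psi> Q\<close> gives the same, and transposing up ends at
      \<open>a i \<squnion> ?z\<close>, still below \<open>?b\<close>.\<close>
    have "a (Suc i) = a i \<sqinter>\<^bsub>M\<^esub> ?z"
    proof (rule M.le_antisym)
      show "a (Suc i) \<sqsubseteq>\<^bsub>M\<^esub> a i \<sqinter>\<^bsub>M\<^esub> ?z" "a i \<sqinter>\<^bsub>M\<^esub> ?z \<sqsubseteq>\<^bsub>M\<^esub> a (Suc i)"
        using ab unfolding aS N by (simp_all add: M.bound_simps)
      show "a (Suc i) \<in> carrier M" by (rule ac)
    qed simp
    then have "steps_in M (a (Suc i)) (a i) \<subseteq> steps_in M ?z (a i \<squnion>\<^bsub>M\<^esub> ?z)"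
      using M.steps_in_transpose_up[of "a i" ?z] by simp
    also have "\<dots> \<subseteq> steps_in M ?z ?b"
      using ab by (intro M.steps_in_mono) (simp_all add: M.bound_simps)
    also have "\<dots> = steps_of_inst M \<phi> (Ns ! i)"
      by (simp add: N steps_of_inst_def meet_ba \<psi>m flip: \<psi>_def)
    finally show ?thesis .
  qed
  \<comment> \<open>Each round splits off the lowest link at \<open>a n\<close>; the trivial
    interval at the start contains no step.\<close>
  have chain: "steps_in M (a n) (\<phi> T) \<subseteq> (\<Union>i<n. steps_in M (a (Suc i)) (a i))" for n
  proof (induction n)
    case 0
    then show ?case by (simp add: a0 M.steps_in_refl)
  next
    case (Suc n)
    have "a (Suc n) \<sqsubseteq>\<^bsub>M\<^esub> a n" by (simp add: aS M.meet_left)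
    then have "steps_in M (a (Suc n)) (\<phi> T) \<subseteq> steps_in M (a (Suc n)) (a n) \<union> steps_in M (a n) (\<phi> T)"
      using M.steps_in_split[of "a (Suc n)" "a n" "\<phi> T"] aT by auto
    with Suc show ?case by (auto simp: lessThan_Suc)
  qed
  have "a (length Ns) \<sqsubseteq>\<^bsub>M\<^esub> \<psi> P" using assms(4) a_le unfolding is_proof_def by blast
  \<comment> \<open>The chain ends below \<open>\<phi> T \<sqinter> \<psi> P\<close>, and lowering
    the bottom of an interval keeps its steps.\<close>
  then have "steps_of_proof M \<phi> T P \<subseteq> steps_in M (a (length Ns)) (\<phi> T)"
    unfolding steps_of_proof_def using aT
    by (intro M.steps_in_mono) (simp_all add: M.le_meet_iff flip: \<psi>_def)
  also have "\<dots> \<subseteq> (\<Union>i<length Ns. steps_of_inst M \<phi> (Ns ! i))"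
    using chain link by blast
  also have "\<dots> \<subseteq> (\<Union>N\<in>set Ns. steps_of_inst M \<phi> N)"
    using nth_mem by blast
  finally show ?thesis unfolding covers_def .
qed

end
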